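(* A weak higher dimensional transition system satisfies the Unique intermediate state axiom if and only if it is orthogonal to the set of inclusions $$\{C_n[a_1,\dots,a_n]^{ext}\subset C_n[a_1,\dots,a_n]\;:\;n\ge0\text{ and }a_1,\dots,a_n\in\Sigma\}.$$
   Context: $\Sigma$ is a fixed nonempty set of labels. A weak higher dimensional transition system is a triple $(S,\mu:L\to\Sigma,T=\bigcup_{n\ge1}T_n)$ with $S$ a set (states), $L$ a set (actions), $\mu$ a set map (labelling map) and $T_n\subset S\times L^n\times S$ ($n$-transitions) such that: - (Multiset axiom) for every permutation $\sigma$ of $\{1,\dots,n\}$, $n\ge2$, if $(\alpha,u_1,\dots,u_n,\beta)\in T$ then $(\alpha,u_{\sigma(1)},\dots,u_{\sigma(n)},\beta)\in T$; - (Coherence axiom) for $n\ge3$, $p,q\ge1$ with $p+q<n$, if $(\alpha,u_1,\dots,u_n,\beta)$, $(\alpha,u_1,\dots,u_p,\nu_1)$, $(\nu_1,u_{p+1},\dots,u_n,\beta)$, $(\alpha,u_1,\dots,u_{p+q},\nu_2)$, $(\nu_2,u_{p+q+1},\dots,u_n,\beta)$ are transitions, then $(\nu_1,u_{p+1},\dots,u_{p+q},\nu_2)$ is a transition. A morphism $f$ consists of a map $f_0$ on states and a map $\widetilde f$ on actions commuting with the labelling maps, such that $(f_0(\alpha),\widetilde f(u_1),\dots,\widetilde f(u_n),f_0(\beta))$ is a transition whenever $(\alpha,u_1,\dots,u_n,\beta)$ is. Unique intermediate state axiom: for every $n\ge2$, every $p$ with $1\le p<n$ and every transition $(\alpha,u_1,\dots,u_n,\beta)$,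 there exists a unique state $\nu$ such that both $(\alpha,u_1,\dots,u_p,\nu)$ and $(\nu,u_{p+1},\dots,u_n,\beta)$ are transitions. $C_n[a_1,\dots,a_n]$ has set of states $\{0,1\}^n$ (the singleton $\{()\}$ for $n=0$), set of actions $\{(a_1,1),\dots,(a_n,n)\}$, labelling $\mu(a_i,i)=a_i$, and its $d$-transitions ($d\ge1$) are the tuples $((\epsilon_1,\dots,\epsilon_n),(a_{i_1},i_1),\dots,(a_{i_d},i_d),(\epsilon_1',\dots,\epsilon_n'))$ with $i_1,\dots,i_d$ pairwise distinct, $\epsilon_i\le\epsilon_i'$ for all $i$, and $\epsilon_i\ne\epsilon_i'$ iff $i\in\{i_1,\dots,i_d\}$. With $0_n=(0,\dots,0)$, $1_n=(1,\dots,1)$ and $0_0=1_0=()$, $C_n[a_1,\dots,a_n]^{ext}$ has set of states $\{0_n,1_n\}$, the same actions and labelling, and transitions the tuples $(0_n,(a_{\sigma(1)},\sigma(1)),\dots,(a_{\sigma(n)},\sigma(n)),1_n)$ for $\sigma$ a permutation of $\{1,\dots,n\}$ (no transitions for $n=0$, so that the inclusion is an equality for $n=0$ and $n=1$). An object $C$ is orthogonal to a map $X\to Y$ if every map $X\to C$ factors uniquely as a composite $X\to Y\to C$; it is orthogonal to a set of maps if it is orthogonal to each of them. *)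

theory Defs
  imports "HOL-Combinatorics.Permutations" "HOL-Library.FuncSet"
begin

text \<open>
  An \<open>n\<close>-transition \<open>(\<alpha>, u\<^sub>1, \<dots>, u\<^sub>n, \<beta>)\<close> is represented as \<open>(\<alpha>, [u\<^sub>1, \<dots>, u\<^sub>n], \<beta>)\<close>, so that \<open>T\<^sub>n\<close>
  consists of the triples of \<open>trans X\<close> whose list of actions has length \<open>n\<close>. The values of
  \<open>label X\<close> outside \<open>actions X\<close> are irrelevant.
\<close>

record ('s, 'l, 'a) hdts =
  states :: "'s set"
  actions :: "'l set"
  label :: "'l \<Rightarrow> 'a"
  trans :: "('s \<times> 'l list \<times> 's) set"

definition multiset_axiom :: "('s, 'l, 'a) hdts \<Rightarrow> bool" where
  "multiset_axiom X \<longleftrightarrow>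
    (\<forall>\<alpha> u \<beta> \<sigma>. 2 \<le> length u \<longrightarrow> \<sigma> permutes {..<length u} \<longrightarrow> (\<alpha>, u, \<beta>) \<in> trans X \<longrightarrow>
      (\<alpha>, permute_list \<sigma> u, \<beta>) \<in> trans X)"

definition coherence_axiom :: "('s, 'l, 'a) hdts \<Rightarrow> bool" where
  "coherence_axiom X \<longleftrightarrow>
    (\<forall>\<alpha> u \<beta> \<nu>\<^sub>1 \<nu>\<^sub>2 p q. 3 \<le> length u \<longrightarrow> 1 \<le> p \<longrightarrow> 1 \<le> q \<longrightarrow> p + q < length u \<longrightarrow>
      (\<alpha>, u, \<beta>) \<in> trans X \<longrightarrow>
      (\<alpha>, take p u, \<nu>\<^sub>1) \<in> trans X \<longrightarrow> (\<nu>\<^sub>1, drop p u, \<beta>) \<in> trans X \<longrightarrow>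
      (\<alpha>, take (p + q) u, \<nu>\<^sub>2) \<in> trans X \<longrightarrow> (\<nu>\<^sub>2, drop (p + q) u, \<beta>) \<in> trans X \<longrightarrow>
      (\<nu>\<^sub>1, take q (drop p u), \<nu>\<^sub>2) \<in> trans X)"

definition weak_hdts :: "'a set \<Rightarrow> ('s, 'l, 'a) hdts \<Rightarrow> bool" where
  "weak_hdts \<Sigma> X \<longleftrightarrow>
    label X \<in> actions X \<rightarrow> \<Sigma> \<and>
    (\<forall>(\<alpha>, u, \<beta>) \<in> trans X. \<alpha> \<in> states X \<and> \<beta> \<in> states X \<and> set u \<subseteq> actions X \<and> 1 \<le> length u) \<and>
    multiset_axiom X \<and> coherence_axiom X"

definition unique_intermediate_state :: "('s, 'l, 'a) hdts \<Rightarrow> bool" where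
  "unique_intermediate_state X \<longleftrightarrow>
    (\<forall>\<alpha> u \<beta> p. 2 \<le> length u \<longrightarrow> 1 \<le> p \<longrightarrow> p < length u \<longrightarrow> (\<alpha>, u, \<beta>) \<in> trans X \<longrightarrow>
      (\<exists>!\<nu>. \<nu> \<in> states X \<and> (\<alpha>, take p u, \<nu>) \<in> trans X \<and> (\<nu>, drop p u, \<beta>) \<in> trans X))"

text \<open>
  A morphism is the pair of its map on states and its map on actions. Both are required to be
  extensional, so that equality of pairs is equality of morphisms.
\<close>

type_synonym ('s, 'l, 't, 'm) hdts_map = "('s \<Rightarrow> 't) \<times> ('l \<Rightarrow> 'm)"

definition hdts_hom ::
  "('s, 'l, 'a) hdts \<Rightarrow> ('t, 'm, 'a) hdts \<Rightarrow> ('s, 'l, 't, 'm) hdts_map set" where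
  "hdts_hom X Y = {(f\<^sub>0, f\<^sub>1).
    f\<^sub>0 \<in> states X \<rightarrow>\<^sub>E states Y \<and> f\<^sub>1 \<in> actions X \<rightarrow>\<^sub>E actions Y \<and>
    (\<forall>u \<in> actions X. label Y (f\<^sub>1 u) = label X u) \<and>
    (\<forall>(\<alpha>, u, \<beta>) \<in> trans X. (f\<^sub>0 \<alpha>, map f\<^sub>1 u, f\<^sub>0 \<beta>) \<in> trans Y)}"

text \<open>The composite \<open>g \<circ> f\<close> of \<open>f\<close> with source \<open>X\<close> and \<open>g\<close>.\<close>

definition hdts_comp ::
  "('s, 'l, 'a) hdts \<Rightarrow> ('t, 'm, 'v, 'w) hdts_map \<Rightarrow> ('s, 'l, 't, 'm) hdts_map
    \<Rightarrow> ('s, 'l, 'v, 'w) hdts_map" where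
  "hdts_comp X g f = (compose (states X) (fst g) (fst f), compose (actions X) (snd g) (snd f))"

text \<open>An arrow \<open>f : X \<rightarrow> Y\<close> is given as the triple \<open>(X, f, Y)\<close>.\<close>

type_synonym ('s, 'l, 't, 'm, 'a) hdts_arrow =
  "('s, 'l, 'a) hdts \<times> ('s, 'l, 't, 'm) hdts_map \<times> ('t, 'm, 'a) hdts"

definition orthogonal_to_map ::
  "('v, 'w, 'a) hdts \<Rightarrow> ('s, 'l, 't, 'm, 'a) hdts_arrow \<Rightarrow> bool" where
  "orthogonal_to_map C = (\<lambda>(X, f, Y).
    \<forall>g \<in> hdts_hom X C. \<exists>!h. h \<in> hdts_hom Y C \<and> hdts_comp X h f = g)"

definition orthogonal_to_set ::
  "('v, 'w, 'a) hdts \<Rightarrow> ('s, 'l, 't, 'm, 'a) hdts_arrow set \<Rightarrow> bool" where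
  "orthogonal_to_set C M \<longleftrightarrow> (\<forall>m \<in> M. orthogonal_to_map C m)"

text \<open>
  The list \<open>as\<close> stands for \<open>a\<^sub>1, \<dots>, a\<^sub>n\<close>. Indices start at \<open>0\<close>: the action \<open>(a\<^sub>i, i)\<close> is
  \<open>(as ! (i - 1), i - 1)\<close>.
\<close>

definition cube :: "'a list \<Rightarrow> (nat list, 'a \<times> nat, 'a) hdts" where
  "cube as = \<lparr>
    states = {\<epsilon>. length \<epsilon> = length as \<and> set \<epsilon> \<subseteq> {0, 1}},
    actions = {(as ! i, i) | i. i < length as},
    label = fst,
    trans = {(\<epsilon>, map (\<lambda>i. (as ! i, i)) js, \<epsilon>') | \<epsilon> js \<epsilon>'.
      length \<epsilon> = length as \<and> set \<epsilon> \<subseteq> {0, 1} \<and> length \<epsilon>' = length as \<and> set \<epsilon>' \<subseteq> {0, 1} \<and>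
      1 \<le> length js \<and> distinct js \<and> set js \<subseteq> {..<length as} \<and>
      (\<forall>i < length as. \<epsilon> ! i \<le> \<epsilon>' ! i) \<and>
      (\<forall>i < length as. \<epsilon> ! i \<noteq> \<epsilon>' ! i \<longleftrightarrow> i \<in> set js)}\<rparr>"

definition cube_ext :: "'a list \<Rightarrow> (nat list, 'a \<times> nat, 'a) hdts" where
  "cube_ext as = \<lparr>
    states = {replicate (length as) 0, replicate (length as) 1},
    actions = {(as ! i, i) | i. i < length as},
    label = fst,
    trans = {(replicate (length as) 0, map (\<lambda>k. (as ! \<sigma> k, \<sigma> k)) [0..<length as],
        replicate (length as) 1) | \<sigma>. 1 \<le> length as \<and> \<sigma> permutes {..<length as}}\<rparr>"

definition cube_inclusion :: "'a list \<Rightarrow> (nat list, 'a \<times> nat, nat list, 'a \<times> nat, 'a) hdts_arrow"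
  where "cube_inclusion as =
    (cube_ext as, (\<lambda>\<epsilon> \<in> states (cube_ext as). \<epsilon>, \<lambda>u \<in> actions (cube_ext as). u), cube as)"

definition cube_inclusions ::
  "'a set \<Rightarrow> (nat list, 'a \<times> nat, nat list, 'a \<times> nat, 'a) hdts_arrow set" where
  "cube_inclusions \<Sigma> = {cube_inclusion as | as. set as \<subseteq> \<Sigma>}"

lemma weak_hdts_cube_ext:
  assumes "set as \<subseteq> \<Sigma>"
  shows "weak_hdts \<Sigma> (cube_ext as)"
proof -
  have "multiset_axiom (cube_ext as)"
    unfolding multiset_axiom_def
  proof (intro allI impI)
    fix \<alpha> u \<beta> \<tau>
    assume t: "\<tau> permutes {..<length u}" and "(\<alpha>, u, \<beta>) \<in> trans (cube_ext as)"
    then obtain \<sigma> where s: "1 \<le> length as" "\<sigma> permutes {..<length as}"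
      and u: "u = map (\<lambda>k. (as ! \<sigma> k, \<sigma> k)) [0..<length as]"
      and ab: "\<alpha> = replicate (length as) 0" "\<beta> = replicate (length as) 1"
      by (auto simp: cube_ext_def)
    have t': "\<tau> permutes {..<length as}"
      using t u by simp
    have "permute_list \<tau> u = map (\<lambda>k. (as ! (\<sigma> \<circ> \<tau>) k, (\<sigma> \<circ> \<tau>) k)) [0..<length as]"
      using permutes_in_image[OF t'] by (auto simp: permute_list_def u)
    then show "(\<alpha>, permute_list \<tau> u, \<beta>) \<in> trans (cube_ext as)"
      using ab s(1) permutes_compose[OF t' s(2)] unfolding cube_ext_def
      by (auto intro!: exI[of _ "\<sigma> \<circ> \<tau>"])
  qed
  moreover have "coherence_axiom (cube_ext as)"
    by (auto simp: coherence_axiom_def cube_ext_def dest!: arg_cong[where f = length])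
  moreover have "\<sigma> k < length as" if "\<sigma> permutes {..<length as}" "k < length as" for \<sigma> k
    using permutes_in_image[OF that(1)] that(2) by auto
  ultimately show ?thesis
    using assms by (fastforce simp: weak_hdts_def cube_ext_def)
qed

lemma cube_trans_iff:
  "(\<epsilon>, u, \<epsilon>') \<in> trans (cube as) \<longleftrightarrow>
    \<epsilon> \<in> states (cube as) \<and> \<epsilon>' \<in> states (cube as) \<and> 1 \<le> length u \<and> distinct u \<and>
    set u \<subseteq> actions (cube as) \<and> (\<forall>i < length as. \<epsilon> ! i \<le> \<epsilon>' ! i) \<and>
    (\<forall>i < length as. \<epsilon> ! i \<noteq> \<epsilon>' ! i \<longleftrightarrow> (as ! i, i) \<in> set u)"  (is "?L \<longleftrightarrow> ?R")
proof
  assume ?L then show ?R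
    by (auto simp: cube_def distinct_map inj_on_def)
next
  assume R: ?R
  then have act: "fst x = as ! snd x" "snd x < length as" if "x \<in> set u" for x
    using that by (auto simp: cube_def)
  have u: "u = map (\<lambda>i. (as ! i, i)) (map snd u)"
    unfolding map_map by (intro map_idI[symmetric]) (simp add: prod_eq_iff act)
  have d: "distinct (map snd u)"
    using R act by (simp add: distinct_map inj_on_def prod_eq_iff)
  have "i \<in> set (map snd u) \<longleftrightarrow> (as ! i, i) \<in> set u" for i
    using act by force
  moreover have "set (map snd u) \<subseteq> {..<length as}"
    using act by auto
  ultimately show ?L
    using R u d unfolding cube_def hdts.simps mem_Collect_eq
    by (intro exI[of _ \<epsilon>] exI[of _ "map snd u"] exI[of _ \<epsilon>'] conjI) simp_all
qed

lemma weak_hdts_cube: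
  assumes "set as \<subseteq> \<Sigma>"
  shows "weak_hdts \<Sigma> (cube as)"
proof -
  have "multiset_axiom (cube as)"
    by (simp add: multiset_axiom_def cube_trans_iff distinct_permute_list)
  moreover have "coherence_axiom (cube as)"
    unfolding coherence_axiom_def
  proof (intro allI impI)
    fix \<alpha> u \<beta> \<nu>1 \<nu>2 p q
    assume *: "1 \<le> p" "1 \<le> q" "p + q < length u" "(\<alpha>, u, \<beta>) \<in> trans (cube as)"
      "(\<alpha>, take p u, \<nu>1) \<in> trans (cube as)" "(\<nu>1, drop p u, \<beta>) \<in> trans (cube as)"
      "(\<alpha>, take (p + q) u, \<nu>2) \<in> trans (cube as)" "(\<nu>2, drop (p + q) u, \<beta>) \<in> trans (cube as)"
    let ?m = "take q (drop p u)"
    have tpq: "take (p + q) u = take p u @ ?m"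
      by (simp add: take_add)
    have "distinct (take p u @ ?m)"
      using *(4) unfolding tpq[symmetric] by (simp add: cube_trans_iff)
    then have dis: "distinct ?m" "set (take p u) \<inter> set ?m = {}"
      by simp_all
    have val: "x ! i = 0 \<or> x ! i = 1" if "x \<in> states (cube as)" "i < length as" for x i
      using that nth_mem[of i x] unfolding cube_def by (auto simp del: nth_mem)
    have st: "\<alpha> \<in> states (cube as)" "\<nu>1 \<in> states (cube as)" "\<nu>2 \<in> states (cube as)"
      using * by (auto simp: cube_trans_iff)
    have key: "\<nu>1 ! i \<le> \<nu>2 ! i \<and> (\<nu>1 ! i \<noteq> \<nu>2 ! i \<longleftrightarrow> (as ! i, i) \<in> set ?m)"
      if i: "i < length as" for i
    proof -
      have "\<alpha> ! i \<le> \<nu>1 ! i" "\<alpha> ! i \<noteq> \<nu>1 ! i \<longleftrightarrow> (as ! i, i) \<in> set (take p u)"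
        "\<alpha> ! i \<le> \<nu>2 ! i" "\<alpha> ! i \<noteq> \<nu>2 ! i \<longleftrightarrow> (as ! i, i) \<in> set (take p u) \<union> set ?m"
        using *(5,7) i unfolding tpq by (auto simp: cube_trans_iff)
      then show ?thesis
        using val[OF st(1) i] val[OF st(2) i] val[OF st(3) i] dis(2)
        disjoint_iff[of "set (take p u)" "set ?m"] by (elim disjE) simp_all
    qed
    have "set ?m \<subseteq> set u"
      by (meson order_trans set_take_subset set_drop_subset)
    then have "set ?m \<subseteq> actions (cube as)"
      using *(4) by (auto simp: cube_trans_iff)
    moreover have "1 \<le> length ?m"
      using *(1-3) by simp
    ultimately show "(\<nu>1, ?m, \<nu>2) \<in> trans (cube as)"
      using dis(1) key st unfolding cube_trans_iff by blast
  qed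
  ultimately show ?thesis
    using assms by (auto simp: weak_hdts_def cube_trans_iff) (auto simp: cube_def)
qed

lemma trans_cube_ext_subset: "trans (cube_ext as) \<subseteq> trans (cube as)"
proof
  fix t
  assume "t \<in> trans (cube_ext as)"
  then obtain \<sigma> where s: "1 \<le> length as" "\<sigma> permutes {..<length as}"
    and t: "t = (replicate (length as) 0, map (\<lambda>k. (as ! \<sigma> k, \<sigma> k)) [0..<length as],
      replicate (length as) 1)"
    by (auto simp: cube_ext_def)
  have "map (\<lambda>k. (as ! \<sigma> k, \<sigma> k)) [0..<length as]
      = map (\<lambda>i. (as ! i, i)) (map \<sigma> [0..<length as])"
    by simp
  moreover have "distinct (map \<sigma> [0..<length as])"
    using permutes_inj_on[OF s(2)] by (simp add: distinct_map)
  moreover have "set (map \<sigma> [0..<length as]) = {..<length as}"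
    using permutes_image[OF s(2)] by (simp add: atLeast0LessThan)
  ultimately show "t \<in> trans (cube as)"
    using s(1) unfolding t cube_def hdts.simps mem_Collect_eq
    by (intro exI[of _ "replicate (length as) 0"] exI[of _ "map \<sigma> [0..<length as]"]
        exI[of _ "replicate (length as) 1"] conjI) auto
qed

lemma cube_inclusion_hom:
  "(\<lambda>\<epsilon> \<in> states (cube_ext as). \<epsilon>, \<lambda>u \<in> actions (cube_ext as). u)
    \<in> hdts_hom (cube_ext as) (cube as)"
proof -
  have "states (cube_ext as) \<subseteq> states (cube as)" "actions (cube_ext as) = actions (cube as)"
    "label (cube_ext as) = label (cube as)"
    by (auto simp: cube_ext_def cube_def)
  moreover have "\<alpha> \<in> states (cube_ext as)" "\<beta> \<in> states (cube_ext as)"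
    "map (\<lambda>u \<in> actions (cube_ext as). u) u = u" if "(\<alpha>, u, \<beta>) \<in> trans (cube_ext as)" for \<alpha> u \<beta>
    using weak_hdts_cube_ext[OF order_refl, of as] that
    by (force simp: weak_hdts_def intro!: map_idI)+
  ultimately show ?thesis
    using trans_cube_ext_subset[of as] by (auto simp: hdts_hom_def)
qed

end

theory Submission
  imports Defs
begin

text \<open>
  The theorem holds because the extensions of a map \<open>g : C\<^sub>n[a\<^sub>1,\<dots>,a\<^sub>n]\<^sup>e\<^sup>x\<^sup>t \<rightarrow> X\<close> to the full cube
  form a product. For \<open>n \<ge> 1\<close>, and up to the order of the actions, which is irrelevant by the
  multiset axiom, such a \<open>g\<close> is a transition of \<open>X\<close> from a state \<open>\<alpha>\<close> to a state \<open>\<beta>\<close> by actions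
  \<open>u\<^sub>1, \<dots>, u\<^sub>n\<close>. A vertex of the cube is a subset \<open>A\<close> of the indices. An extension must send a
  proper nonempty \<open>A\<close> to a state that is intermediate between the actions indexed by \<open>A\<close> and the
  others. Conversely these states can be chosen independently of each other. Indeed, for such sets
  \<open>A \<subset> B\<close> the transition between the states chosen for \<open>A\<close> and \<open>B\<close>, labelled by the actions
  indexed by \<open>B - A\<close>, is exactly what the coherence axiom provides (\<open>cube_extension_iff\<close>).

  So the extension of \<open>g\<close> exists and is unique if and only if each factor of the product is a
  singleton, that is, if there is exactly one intermediate state for every way of cutting the set
  of actions in two. This is the Unique intermediate state axiom up to reordering the actions, and
  every transition of \<open>X\<close> arises from some \<open>g\<close>.
\<close>

section \<open>Transitions indexed by finite sets of actions\<close>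

lemma trans_mset_cong:
  assumes "weak_hdts \<Sigma> X" and "mset u = mset v" and "(\<alpha>, u, \<beta>) \<in> trans X"
  shows "(\<alpha>, v, \<beta>) \<in> trans X"
proof (cases "2 \<le> length u")
  case True
  obtain \<sigma> where "\<sigma> permutes {..<length u}" "permute_list \<sigma> u = v"
    using mset_eq_permutation[OF assms(2)[symmetric]] by blast
  then show ?thesis
    using assms(1,3) True unfolding weak_hdts_def multiset_axiom_def by blast
next
  case False
  have len: "length v = length u"
    using assms(2) mset_eq_length by metis
  have "u = v"
  proof (cases u)
    case Nil
    then show ?thesis using assms(2) by simp
  next
    case (Cons a u')
    then have "u = [a]" using False by (cases u') simp_all
    then show ?thesis using assms(2) by simp
  qed
  then show ?thesis using assms(3) by simp
qed

lemma trans_wf: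
  assumes "weak_hdts \<Sigma> X" and "(\<alpha>, u, \<beta>) \<in> trans X"
  shows "\<alpha> \<in> states X" "\<beta> \<in> states X" "set u \<subseteq> actions X" "u \<noteq> []"
  using assms unfolding weak_hdts_def by force+

lemma coherence_append:
  assumes "weak_hdts \<Sigma> X" and "x \<noteq> []" "y \<noteq> []" "z \<noteq> []"
    and "(\<alpha>, x @ y @ z, \<beta>) \<in> trans X"
    and "(\<alpha>, x, \<nu>\<^sub>1) \<in> trans X" "(\<nu>\<^sub>1, y @ z, \<beta>) \<in> trans X"
    and "(\<alpha>, x @ y, \<nu>\<^sub>2) \<in> trans X" "(\<nu>\<^sub>2, z, \<beta>) \<in> trans X"
  shows "(\<nu>\<^sub>1, y, \<nu>\<^sub>2) \<in> trans X"
proof -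
  have "3 \<le> length (x @ y @ z)" "1 \<le> length x" "1 \<le> length y"
    "length x + length y < length (x @ y @ z)"
    using assms(2-4) by (cases x; cases y; cases z; simp)+
  moreover have "coherence_axiom X"
    using assms(1) by (simp add: weak_hdts_def)
  ultimately have "(\<nu>\<^sub>1, take (length y) (drop (length x) (x @ y @ z)), \<nu>\<^sub>2) \<in> trans X"
    unfolding coherence_axiom_def using assms(5-9)
    by (elim allE[of _ \<alpha>] allE[of _ "x @ y @ z"] allE[of _ \<beta>] allE[of _ \<nu>\<^sub>1] allE[of _ \<nu>\<^sub>2]
        allE[of _ "length x"] allE[of _ "length y"]) simp
  then show ?thesis by simp
qed

text \<open>
  The actions of a transition are indexed by \<open>U\<close> rather than collected in a set, because a
  transition may use the same action several times.
\<close>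

definition step :: "('s, 'l, 'a) hdts \<Rightarrow> ('i \<Rightarrow> 'l) \<Rightarrow> 's \<Rightarrow> 'i set \<Rightarrow> 's \<Rightarrow> bool" where
  "step X U \<alpha> A \<beta> \<longleftrightarrow> (\<exists>js. distinct js \<and> set js = A \<and> (\<alpha>, map U js, \<beta>) \<in> trans X)"

lemma step_set_iff:
  assumes "weak_hdts \<Sigma> X" and "distinct js"
  shows "step X U \<alpha> (set js) \<beta> \<longleftrightarrow> (\<alpha>, map U js, \<beta>) \<in> trans X"
proof
  assume "step X U \<alpha> (set js) \<beta>"
  then obtain ks where ks: "distinct ks" "set ks = set js" "(\<alpha>, map U ks, \<beta>) \<in> trans X"
    unfolding step_def by blast
  then have "mset ks = mset js"
    using assms(2) set_eq_iff_mset_eq_distinct by blast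
  then have "mset (map U ks) = mset (map U js)"
    by simp
  then show "(\<alpha>, map U js, \<beta>) \<in> trans X"
    using trans_mset_cong[OF assms(1)] ks(3) by blast
next
  assume "(\<alpha>, map U js, \<beta>) \<in> trans X"
  then show "step X U \<alpha> (set js) \<beta>"
    using assms(2) unfolding step_def by blast
qed

lemma step_iff_all:
  assumes "weak_hdts \<Sigma> X" and "finite A"
  shows "step X U \<alpha> A \<beta> \<longleftrightarrow>
    (\<forall>js. distinct js \<longrightarrow> set js = A \<longrightarrow> (\<alpha>, map U js, \<beta>) \<in> trans X)"
proof -
  obtain ks where "distinct ks" "set ks = A"
    using finite_distinct_list[OF assms(2)] by blast
  then show ?thesis
    using step_set_iff[OF assms(1)] by blast
qed

lemma step_states:
  assumes "weak_hdts \<Sigma> X" and "step X U \<alpha> A \<beta>"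
  shows "\<alpha> \<in> states X" "\<beta> \<in> states X"
  using assms trans_wf(1,2)[OF assms(1)] unfolding step_def by blast+

text \<open>
  The coherence axiom, freed of the order of the actions: one enumerates \<open>A\<close>, \<open>B - A\<close> and \<open>N - B\<close>
  one after the other, so that \<open>A\<close> and \<open>B\<close> become initial segments.
\<close>

lemma step_coherence:
  assumes w: "weak_hdts \<Sigma> X" and "finite N" and AB: "A \<noteq> {}" "A \<subset> B" "B \<subset> N"
    and "step X U \<alpha> N \<beta>"
    and "step X U \<alpha> A \<nu>\<^sub>1" "step X U \<nu>\<^sub>1 (N - A) \<beta>"
    and "step X U \<alpha> B \<nu>\<^sub>2" "step X U \<nu>\<^sub>2 (N - B) \<beta>"
  shows "step X U \<nu>\<^sub>1 (B - A) \<nu>\<^sub>2"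
proof -
  have "finite A" "finite (B - A)" "finite (N - B)"
    using AB assms(2) by (meson finite_Diff finite_subset psubset_imp_subset)+
  then obtain x y z where x: "set x = A" "distinct x" and y: "set y = B - A" "distinct y"
    and z: "set z = N - B" "distinct z"
    using finite_distinct_list by metis
  have d: "distinct (x @ y @ z)" "distinct (y @ z)" "distinct (x @ y)"
    using x y z AB by auto
  have s: "N = set (x @ y @ z)" "N - A = set (y @ z)" "B = set (x @ y)"
    using x y z AB by auto
  have "map U x \<noteq> []" "map U y \<noteq> []" "map U z \<noteq> []"
    using x y z AB by auto
  moreover have "(\<alpha>, map U x @ map U y @ map U z, \<beta>) \<in> trans X"
    using assms(6) step_set_iff[OF w d(1), of U] s(1) by simp
  moreover have "(\<alpha>, map U x, \<nu>\<^sub>1) \<in> trans X"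
    using assms(7) step_set_iff[OF w x(2), of U] x(1) by simp
  moreover have "(\<nu>\<^sub>1, map U y @ map U z, \<beta>) \<in> trans X"
    using assms(8) step_set_iff[OF w d(2), of U] s(2) by simp
  moreover have "(\<alpha>, map U x @ map U y, \<nu>\<^sub>2) \<in> trans X"
    using assms(9) step_set_iff[OF w d(3), of U] s(3) by simp
  moreover have "(\<nu>\<^sub>2, map U z, \<beta>) \<in> trans X"
    using assms(10) step_set_iff[OF w z(2), of U] z(1) by simp
  ultimately have "(\<nu>\<^sub>1, map U y, \<nu>\<^sub>2) \<in> trans X"
    by (rule coherence_append[OF w])
  then show ?thesis
    using step_set_iff[OF w y(2), of U] y(1) by simp
qed

definition intermediate_states ::
    "('s, 'l, 'a) hdts \<Rightarrow> ('i \<Rightarrow> 'l) \<Rightarrow> 's \<Rightarrow> 's \<Rightarrow> 'i set \<Rightarrow> 'i set \<Rightarrow> 's set" where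
  "intermediate_states X U \<alpha> \<beta> N A = {\<nu>. step X U \<alpha> A \<nu> \<and> step X U \<nu> (N - A) \<beta>}"

text \<open>
  The multiset axiom allows any set of positions to be moved to the front, so the Unique
  intermediate state axiom, which only cuts a list after its first \<open>p\<close> actions, controls all cuts.
\<close>

lemma unique_intermediate_state_step:
  assumes w: "weak_hdts \<Sigma> X" and "unique_intermediate_state X"
    and "finite N" "A \<noteq> {}" "A \<subset> N" and "step X U \<alpha> N \<beta>"
  shows "\<exists>\<nu>. intermediate_states X U \<alpha> \<beta> N A = {\<nu>}"
proof -
  have "finite A" "finite (N - A)"
    using assms(3,5) by (meson finite_Diff finite_subset psubset_imp_subset)+
  then obtain x y where x: "set x = A" "distinct x" and y: "set y = N - A" "distinct y"
    using finite_distinct_list by metis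
  have d: "distinct (x @ y)" and s: "set (x @ y) = N"
    using x y assms(5) by auto
  let ?u = "map U (x @ y)"
  have ne: "x \<noteq> []" "y \<noteq> []"
    using x y assms(4,5) by auto
  then have "2 \<le> length ?u" "1 \<le> length x" "length x < length ?u"
    by (cases x; cases y; simp)+
  moreover have "(\<alpha>, ?u, \<beta>) \<in> trans X"
    using assms(6) step_set_iff[OF w d, of U] s by simp
  ultimately have "\<exists>!\<nu>. \<nu> \<in> states X \<and> (\<alpha>, take (length x) ?u, \<nu>) \<in> trans X \<and>
      (\<nu>, drop (length x) ?u, \<beta>) \<in> trans X"
    using assms(2) unfolding unique_intermediate_state_def by blast
  then have "\<exists>!\<nu>. (\<alpha>, map U x, \<nu>) \<in> trans X \<and> (\<nu>, map U y, \<beta>) \<in> trans X"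
    using trans_wf(1)[OF w] by (auto simp: take_map drop_map)
  then show ?thesis
    unfolding intermediate_states_def x(1)[symmetric] y(1)[symmetric, unfolded x(1)[symmetric]]
      step_set_iff[OF w x(2)] step_set_iff[OF w y(2)]
    by blast
qed

section \<open>Maps out of cubes\<close>

definition ones :: "nat list \<Rightarrow> nat set" where
  "ones \<epsilon> = {i. i < length \<epsilon> \<and> \<epsilon> ! i = 1}"

lemma finite_ones [simp]: "finite (ones \<epsilon>)"
  by (simp add: ones_def)

lemma ones_replicate [simp]:
  "ones (replicate n 0) = {}" "ones (replicate n (Suc 0)) = {..<n}"
  by (auto simp: ones_def)

lemma ones_subset: "\<epsilon> \<in> states (cube as) \<Longrightarrow> ones \<epsilon> \<subseteq> {..<length as}"
  by (auto simp: ones_def cube_def)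

lemma cube_state_nth:
  assumes "\<epsilon> \<in> states (cube as)" and "i < length as"
  shows "\<epsilon> ! i = (if i \<in> ones \<epsilon> then 1 else 0)"
proof -
  have "\<epsilon> ! i \<in> {0, 1}" "length \<epsilon> = length as"
    using assms nth_mem[of i \<epsilon>] unfolding cube_def by (auto simp del: nth_mem)
  then show ?thesis using assms(2) by (auto simp: ones_def)
qed

lemma cube_state_eqI:
  assumes "\<epsilon> \<in> states (cube as)" "\<epsilon>' \<in> states (cube as)" "ones \<epsilon> = ones \<epsilon>'"
  shows "\<epsilon> = \<epsilon>'"
  using assms cube_state_nth[OF assms(1)] cube_state_nth[OF assms(2)]
  by (intro nth_equalityI) (auto simp: cube_def)

lemma replicate_in_cube [simp]:
  "replicate (length as) 0 \<in> states (cube as)" "replicate (length as) 1 \<in> states (cube as)"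
  "replicate (length as) (Suc 0) \<in> states (cube as)"
  by (auto simp: cube_def)

lemma states_cube_ext [simp]:
  "states (cube_ext as) = {replicate (length as) 0, replicate (length as) 1}"
  by (simp add: cube_ext_def)

lemma actions_cube_ext [simp]: "actions (cube_ext as) = actions (cube as)"
  by (simp add: cube_ext_def cube_def)

text \<open>
  Identifying a vertex with the set of its coordinates equal to \<open>1\<close> turns the cube into the
  lattice of subsets of \<open>{..<n}\<close>, with one joint transition, in all its orders, for every strict
  inclusion.
\<close>

lemma cube_trans_ones_iff:
  "(\<epsilon>, u, \<epsilon>') \<in> trans (cube as) \<longleftrightarrow>
    \<epsilon> \<in> states (cube as) \<and> \<epsilon>' \<in> states (cube as) \<and> ones \<epsilon> \<subset> ones \<epsilon>' \<and>
    (\<exists>js. distinct js \<and> set js = ones \<epsilon>' - ones \<epsilon> \<and> u = map (\<lambda>i. (as ! i, i)) js)"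
    (is "?L \<longleftrightarrow> ?R")
proof -
  have *: "(\<forall>i < length as. \<epsilon> ! i \<le> \<epsilon>' ! i) \<and>
      (\<forall>i < length as. \<epsilon> ! i \<noteq> \<epsilon>' ! i \<longleftrightarrow> i \<in> set js) \<and> 1 \<le> length js \<and> set js \<subseteq> {..<length as}
    \<longleftrightarrow> ones \<epsilon> \<subset> ones \<epsilon>' \<and> set js = ones \<epsilon>' - ones \<epsilon>"
    if st: "\<epsilon> \<in> states (cube as)" "\<epsilon>' \<in> states (cube as)" for js
  proof -
    note n = cube_state_nth[OF st(1)] cube_state_nth[OF st(2)]
    note o = ones_subset[OF st(1)] ones_subset[OF st(2)]
    have 1: "(\<forall>i < length as. \<epsilon> ! i \<le> \<epsilon>' ! i) \<longleftrightarrow> ones \<epsilon> \<subseteq> ones \<epsilon>'"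
      using n o by (auto split: if_splits)
    have 2: "(\<forall>i < length as. \<epsilon> ! i \<noteq> \<epsilon>' ! i \<longleftrightarrow> i \<in> set js) \<and> set js \<subseteq> {..<length as}
        \<longleftrightarrow> set js = ones \<epsilon>' - ones \<epsilon>" if "ones \<epsilon> \<subseteq> ones \<epsilon>'"
      using n o that by (auto split: if_splits)
    have 3: "1 \<le> length js \<longleftrightarrow> ones \<epsilon> \<noteq> ones \<epsilon>'"
      if "ones \<epsilon> \<subseteq> ones \<epsilon>'" "set js = ones \<epsilon>' - ones \<epsilon>"
    proof -
      have "1 \<le> length js \<longleftrightarrow> set js \<noteq> {}"
        by (cases js) simp_all
      moreover have "ones \<epsilon>' - ones \<epsilon> \<noteq> {} \<longleftrightarrow> ones \<epsilon> \<noteq> ones \<epsilon>'"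
        using that(1) by auto
      ultimately show ?thesis by (simp only: that(2))
    qed
    show ?thesis
    proof (cases "ones \<epsilon> \<subseteq> ones \<epsilon>'")
      case True
      have "(P \<and> L \<and> S) = (N \<and> E)" if "(P \<and> S) = E" "E \<Longrightarrow> L = N" for P L S N E
        using that by blast
      from this[OF 2[OF True] 3[OF True]] show ?thesis
        by (simp only: 1 True psubset_eq simp_thms conj_assoc)
    next
      case False
      then show ?thesis
        by (simp only: 1 psubset_eq simp_thms)
    qed
  qed
  have "?L \<longleftrightarrow> \<epsilon> \<in> states (cube as) \<and> \<epsilon>' \<in> states (cube as) \<and>
    (\<exists>js. ((\<forall>i < length as. \<epsilon> ! i \<le> \<epsilon>' ! i) \<and>
      (\<forall>i < length as. \<epsilon> ! i \<noteq> \<epsilon>' ! i \<longleftrightarrow> i \<in> set js) \<and> 1 \<le> length js \<and> set js \<subseteq> {..<length as})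
      \<and> distinct js \<and> u = map (\<lambda>i. (as ! i, i)) js)"
    unfolding cube_def by auto
  also have "\<dots> \<longleftrightarrow> \<epsilon> \<in> states (cube as) \<and> \<epsilon>' \<in> states (cube as) \<and>
    (\<exists>js. (ones \<epsilon> \<subset> ones \<epsilon>' \<and> set js = ones \<epsilon>' - ones \<epsilon>) \<and> distinct js \<and>
      u = map (\<lambda>i. (as ! i, i)) js)"
    by (simp only: * cong: conj_cong)
  finally show ?thesis by blast
qed

lemma cube_ext_trans_iff:
  "(\<epsilon>, u, \<epsilon>') \<in> trans (cube_ext as) \<longleftrightarrow>
    as \<noteq> [] \<and> \<epsilon> = replicate (length as) 0 \<and> \<epsilon>' = replicate (length as) 1 \<and>
    (\<exists>js. distinct js \<and> set js = {..<length as} \<and> u = map (\<lambda>i. (as ! i, i)) js)"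
    (is "?L \<longleftrightarrow> ?R")
proof
  assume ?L
  then obtain \<sigma> where s: "\<sigma> permutes {..<length as}" and ne: "1 \<le> length as"
    and eq: "\<epsilon> = replicate (length as) 0" "\<epsilon>' = replicate (length as) 1"
      "u = map (\<lambda>i. (as ! i, i)) (map \<sigma> [0..<length as])"
    by (auto simp: cube_ext_def)
  have "distinct (map \<sigma> [0..<length as])" "set (map \<sigma> [0..<length as]) = {..<length as}"
    using permutes_inj_on[OF s] permutes_image[OF s]
    by (simp_all add: distinct_map atLeast0LessThan)
  then show ?R using ne eq by (metis One_nat_def list.size(3) not_one_le_zero)
next
  assume R: ?R
  then obtain js where js: "distinct js" "set js = {..<length as}"
    and u: "u = map (\<lambda>i. (as ! i, i)) js" by blast
  have "mset js = mset [0..<length as]"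
    using js set_eq_iff_mset_eq_distinct[of js "[0..<length as]"]
    by (simp add: atLeast0LessThan)
  then obtain \<sigma> where s: "\<sigma> permutes {..<length as}" "permute_list \<sigma> [0..<length as] = js"
    using mset_eq_permutation[of js "[0..<length as]"] by auto
  have "\<sigma> k < length as" if "k < length as" for k
    using permutes_in_image[OF s(1)] that by auto
  then have "js = map \<sigma> [0..<length as]"
    unfolding s(2)[symmetric] permute_list_def by simp
  then have "u = map (\<lambda>k. (as ! \<sigma> k, \<sigma> k)) [0..<length as]"
    using u by simp
  moreover have "1 \<le> length as"
    using R by (cases as) auto
  ultimately show ?L
    using R s(1) unfolding cube_ext_def by auto
qed

lemma cube_hom_iff:
  "(h\<^sub>0, h\<^sub>1) \<in> hdts_hom (cube as) X \<longleftrightarrow>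
    h\<^sub>0 \<in> states (cube as) \<rightarrow>\<^sub>E states X \<and> h\<^sub>1 \<in> actions (cube as) \<rightarrow>\<^sub>E actions X \<and>
    (\<forall>u \<in> actions (cube as). label X (h\<^sub>1 u) = label (cube as) u) \<and>
    (\<forall>\<epsilon> \<in> states (cube as). \<forall>\<epsilon>' \<in> states (cube as). ones \<epsilon> \<subset> ones \<epsilon>' \<longrightarrow>
      (\<forall>js. distinct js \<longrightarrow> set js = ones \<epsilon>' - ones \<epsilon> \<longrightarrow>
        (h\<^sub>0 \<epsilon>, map (\<lambda>i. h\<^sub>1 (as ! i, i)) js, h\<^sub>0 \<epsilon>') \<in> trans X))"
proof -
  have "(\<forall>(\<epsilon>, u, \<epsilon>') \<in> trans (cube as). (h\<^sub>0 \<epsilon>, map h\<^sub>1 u, h\<^sub>0 \<epsilon>') \<in> trans X) \<longleftrightarrow>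
    (\<forall>\<epsilon> \<in> states (cube as). \<forall>\<epsilon>' \<in> states (cube as). ones \<epsilon> \<subset> ones \<epsilon>' \<longrightarrow>
      (\<forall>js. distinct js \<longrightarrow> set js = ones \<epsilon>' - ones \<epsilon> \<longrightarrow>
        (h\<^sub>0 \<epsilon>, map h\<^sub>1 (map (\<lambda>i. (as ! i, i)) js), h\<^sub>0 \<epsilon>') \<in> trans X))"
    unfolding Ball_def split_paired_all split_paired_All prod.case cube_trans_ones_iff
    by blast
  then show ?thesis
    unfolding hdts_hom_def by (simp add: comp_def)
qed

lemma cube_hom_step_iff:
  assumes w: "weak_hdts \<Sigma> X"
  shows "(h\<^sub>0, h\<^sub>1) \<in> hdts_hom (cube as) X \<longleftrightarrow>
    h\<^sub>0 \<in> states (cube as) \<rightarrow>\<^sub>E states X \<and> h\<^sub>1 \<in> actions (cube as) \<rightarrow>\<^sub>E actions X \<and>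
    (\<forall>u \<in> actions (cube as). label X (h\<^sub>1 u) = fst u) \<and>
    (\<forall>\<epsilon> \<in> states (cube as). \<forall>\<epsilon>' \<in> states (cube as). ones \<epsilon> \<subset> ones \<epsilon>' \<longrightarrow>
      step X (\<lambda>i. h\<^sub>1 (as ! i, i)) (h\<^sub>0 \<epsilon>) (ones \<epsilon>' - ones \<epsilon>) (h\<^sub>0 \<epsilon>'))"
proof -
  have "label (cube as) = fst"
    by (simp add: cube_def)
  then show ?thesis
    unfolding cube_hom_iff step_iff_all[OF w finite_Diff[OF finite_ones]] by simp
qed

lemma cube_ext_hom_step_iff:
  assumes w: "weak_hdts \<Sigma> X"
  shows "(g\<^sub>0, g\<^sub>1) \<in> hdts_hom (cube_ext as) X \<longleftrightarrow>
    g\<^sub>0 \<in> states (cube_ext as) \<rightarrow>\<^sub>E states X \<and> g\<^sub>1 \<in> actions (cube as) \<rightarrow>\<^sub>E actions X \<and>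
    (\<forall>u \<in> actions (cube as). label X (g\<^sub>1 u) = fst u) \<and>
    (as \<noteq> [] \<longrightarrow> step X (\<lambda>i. g\<^sub>1 (as ! i, i)) (g\<^sub>0 (replicate (length as) 0)) {..<length as}
      (g\<^sub>0 (replicate (length as) 1)))"
proof -
  have "(\<forall>(\<epsilon>, u, \<epsilon>') \<in> trans (cube_ext as). (g\<^sub>0 \<epsilon>, map g\<^sub>1 u, g\<^sub>0 \<epsilon>') \<in> trans X) \<longleftrightarrow>
    (as \<noteq> [] \<longrightarrow> (\<forall>js. distinct js \<longrightarrow> set js = {..<length as} \<longrightarrow>
      (g\<^sub>0 (replicate (length as) 0), map g\<^sub>1 (map (\<lambda>i. (as ! i, i)) js),
        g\<^sub>0 (replicate (length as) 1)) \<in> trans X))"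
    unfolding Ball_def split_paired_all split_paired_All prod.case cube_ext_trans_iff
    by blast
  moreover have "label (cube_ext as) = fst"
    by (simp add: cube_ext_def)
  ultimately show ?thesis
    unfolding hdts_hom_def step_iff_all[OF w finite_lessThan] by (simp add: comp_def)
qed

section \<open>Extensions from the extreme vertices to the cube\<close>

text \<open>
  The factors of the product: the states to which an extension of \<open>g\<close> may send the vertex \<open>\<epsilon>\<close>.
  For \<open>n \<le> 1\<close> every vertex is extreme, and \<open>g\<close> alone determines the product.
\<close>

definition vertex_states ::
    "('s, 'l, 'a) hdts \<Rightarrow> 'a list \<Rightarrow> (nat list, 'a \<times> nat, 's, 'l) hdts_map \<Rightarrow> nat list \<Rightarrow> 's set"
  where
  "vertex_states X as g \<epsilon> =
    (if \<epsilon> \<in> states (cube_ext as) then {fst g \<epsilon>}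
     else intermediate_states X (\<lambda>i. snd g (as ! i, i)) (fst g (replicate (length as) 0))
       (fst g (replicate (length as) 1)) {..<length as} (ones \<epsilon>))"

lemma not_in_cube_ext:
  assumes "\<epsilon> \<in> states (cube as)" and "\<epsilon> \<notin> states (cube_ext as)"
  shows "ones \<epsilon> \<noteq> {}" "ones \<epsilon> \<subset> {..<length as}"
proof -
  have "ones \<epsilon> \<noteq> ones (replicate (length as) 0)" "ones \<epsilon> \<noteq> ones (replicate (length as) 1)"
    using cube_state_eqI[OF assms(1) replicate_in_cube(1)]
      cube_state_eqI[OF assms(1) replicate_in_cube(2)] assms(2)
    unfolding states_cube_ext by blast+
  then show "ones \<epsilon> \<noteq> {}" "ones \<epsilon> \<subset> {..<length as}"
    using ones_subset[OF assms(1)] by auto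
qed

lemma restriction_to_cube_ext_iff:
  assumes "g \<in> hdts_hom (cube_ext as) X" and "snd h \<in> actions (cube as) \<rightarrow>\<^sub>E actions X"
  shows "hdts_comp (cube_ext as) h
      (\<lambda>\<epsilon> \<in> states (cube_ext as). \<epsilon>, \<lambda>u \<in> actions (cube_ext as). u) = g \<longleftrightarrow>
    (\<forall>\<epsilon> \<in> states (cube_ext as). fst h \<epsilon> = fst g \<epsilon>) \<and> snd h = snd g"
proof -
  let ?S = "states (cube_ext as)" and ?A = "actions (cube as)"
  have c: "compose S f (\<lambda>x \<in> S. x) = restrict f S" for S and f :: "'x \<Rightarrow> 'y"
    by (auto simp: compose_def)
  have g: "fst g \<in> extensional ?S" "snd g \<in> extensional ?A"
    using assms(1) by (auto simp: hdts_hom_def PiE_def)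
  have "restrict (fst h) ?S = fst g \<longleftrightarrow> (\<forall>\<epsilon> \<in> ?S. fst h \<epsilon> = fst g \<epsilon>)"
  proof
    assume "restrict (fst h) ?S = fst g"
    then show "\<forall>\<epsilon> \<in> ?S. fst h \<epsilon> = fst g \<epsilon>"
      by (metis restrict_apply')
  next
    assume "\<forall>\<epsilon> \<in> ?S. fst h \<epsilon> = fst g \<epsilon>"
    then show "restrict (fst h) ?S = fst g"
      by (intro extensionalityI[OF restrict_extensional g(1)]) (simp del: states_cube_ext)
  qed
  moreover have "restrict (snd h) ?A = snd h"
    using assms(2) by (simp add: PiE_def extensional_restrict)
  ultimately show ?thesis
    unfolding hdts_comp_def prod_eq_iff fst_conv snd_conv c by (simp del: states_cube_ext)
qed

text \<open>
  The constraints on an extension, which link all pairs of comparable vertices, decouple into one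
  constraint per vertex. Necessity looks only at the pairs of \<open>\<epsilon>\<close> with the bottom and the top
  vertex; for a pair of other vertices, the coherence axiom recovers the transition from these four
  transitions and the one between the extreme vertices.
\<close>

lemma cube_extension_iff:
  assumes w: "weak_hdts \<Sigma> X" and g: "g \<in> hdts_hom (cube_ext as) X"
  shows "h \<in> hdts_hom (cube as) X \<and> hdts_comp (cube_ext as) h
      (\<lambda>\<epsilon> \<in> states (cube_ext as). \<epsilon>, \<lambda>u \<in> actions (cube_ext as). u) = g \<longleftrightarrow>
    fst h \<in> (\<Pi>\<^sub>E \<epsilon> \<in> states (cube as). vertex_states X as g \<epsilon>) \<and> snd h = snd g"
    (is "?L \<longleftrightarrow> ?R")
proof -
  let ?n = "length as"
  let ?U = "\<lambda>i. snd g (as ! i, i)" and ?N = "{..<length as}"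
  let ?z = "replicate ?n 0" and ?o = "replicate ?n 1"
  let ?\<alpha> = "fst g ?z" and ?\<beta> = "fst g ?o"
  have g': "fst g \<in> states (cube_ext as) \<rightarrow>\<^sub>E states X" "snd g \<in> actions (cube as) \<rightarrow>\<^sub>E actions X"
    "\<forall>u \<in> actions (cube as). label X (snd g u) = fst u"
    "as \<noteq> [] \<Longrightarrow> step X ?U ?\<alpha> ?N ?\<beta>"
    using g cube_ext_hom_step_iff[OF w, of "fst g" "snd g" as] by auto
  show ?thesis
  proof
    assume L: ?L
    have hom: "fst h \<in> states (cube as) \<rightarrow>\<^sub>E states X" "snd h \<in> actions (cube as) \<rightarrow>\<^sub>E actions X"
      "\<And>\<epsilon> \<epsilon>'. \<epsilon> \<in> states (cube as) \<Longrightarrow> \<epsilon>' \<in> states (cube as) \<Longrightarrow> ones \<epsilon> \<subset> ones \<epsilon>' \<Longrightarrow>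
        step X (\<lambda>i. snd h (as ! i, i)) (fst h \<epsilon>) (ones \<epsilon>' - ones \<epsilon>) (fst h \<epsilon>')"
      using L cube_hom_step_iff[OF w, of "fst h" "snd h" as] by auto
    have r: "\<forall>\<epsilon> \<in> states (cube_ext as). fst h \<epsilon> = fst g \<epsilon>" "snd h = snd g"
      using L restriction_to_cube_ext_iff[OF g hom(2)] by blast+
    have "fst h \<epsilon> \<in> vertex_states X as g \<epsilon>" if \<epsilon>: "\<epsilon> \<in> states (cube as)" for \<epsilon>
    proof (cases "\<epsilon> \<in> states (cube_ext as)")
      case True
      then show ?thesis using r by (simp add: vertex_states_def del: states_cube_ext)
    next
      case False
      note A = not_in_cube_ext[OF \<epsilon> False]
      have "step X ?U ?\<alpha> (ones \<epsilon>) (fst h \<epsilon>)"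
        using hom(3)[OF replicate_in_cube(1) \<epsilon>] A(1) r by (auto simp: psubset_eq)
      moreover have "step X ?U (fst h \<epsilon>) (?N - ones \<epsilon>) ?\<beta>"
        using hom(3)[OF \<epsilon> replicate_in_cube(2)] A(2) r by auto
      ultimately show ?thesis
        using False by (simp add: vertex_states_def intermediate_states_def del: states_cube_ext)
    qed
    then show ?R using hom(1) r(2) by (auto simp: PiE_def)
  next
    assume R: ?R
    then have val: "\<And>\<epsilon>. \<epsilon> \<in> states (cube as) \<Longrightarrow> fst h \<epsilon> \<in> vertex_states X as g \<epsilon>"
      and ext: "fst h \<in> extensional (states (cube as))" and h1: "snd h = snd g"
      by (auto simp: PiE_def)
    have inner: "step X ?U ?\<alpha> (ones \<epsilon>) (fst h \<epsilon>)" "step X ?U (fst h \<epsilon>) (?N - ones \<epsilon>) ?\<beta>"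
      if "\<epsilon> \<in> states (cube as)" "\<epsilon> \<notin> states (cube_ext as)" for \<epsilon>
      using val[OF that(1)] that(2)
      by (simp_all add: vertex_states_def intermediate_states_def del: states_cube_ext)
    have outer: "fst h \<epsilon> = fst g \<epsilon>" if "\<epsilon> \<in> states (cube_ext as)" for \<epsilon>
      using val[of \<epsilon>] that by (auto simp: vertex_states_def)
    have in_states: "fst h \<epsilon> \<in> states X" if "\<epsilon> \<in> states (cube as)" for \<epsilon>
      using outer[of \<epsilon>] inner(1)[OF that] step_states(2)[OF w] PiE_mem[OF g'(1), of \<epsilon>]
      by (cases "\<epsilon> \<in> states (cube_ext as)") (auto simp del: states_cube_ext)
    have "step X ?U (fst h \<epsilon>) (ones \<epsilon>' - ones \<epsilon>) (fst h \<epsilon>')"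
      if \<epsilon>: "\<epsilon> \<in> states (cube as)" "\<epsilon>' \<in> states (cube as)" and less: "ones \<epsilon> \<subset> ones \<epsilon>'" for \<epsilon> \<epsilon>'
    proof -
      have ne: "as \<noteq> []"
        using less ones_subset[OF \<epsilon>(2)] by auto
      have zero: "\<epsilon> \<in> states (cube_ext as) \<Longrightarrow> \<epsilon> = ?z"
        using less ones_subset[OF \<epsilon>(2)] by auto
      have one: "\<epsilon>' \<in> states (cube_ext as) \<Longrightarrow> \<epsilon>' = ?o"
        using less by auto
      show ?thesis
      proof (cases "\<epsilon> \<in> states (cube_ext as)"; cases "\<epsilon>' \<in> states (cube_ext as)")
        assume "\<epsilon> \<in> states (cube_ext as)" "\<epsilon>' \<in> states (cube_ext as)"
        then show ?thesis
          using outer[of \<epsilon>] outer[of \<epsilon>'] zero one g'(4)[OF ne] by simp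
      next
        assume "\<epsilon> \<in> states (cube_ext as)" "\<epsilon>' \<notin> states (cube_ext as)"
        then show ?thesis
          using outer[of \<epsilon>] inner(1)[OF \<epsilon>(2)] zero by simp
      next
        assume "\<epsilon> \<notin> states (cube_ext as)" "\<epsilon>' \<in> states (cube_ext as)"
        then show ?thesis
          using inner(2)[OF \<epsilon>(1)] outer[of \<epsilon>'] one by simp
      next
        assume *: "\<epsilon> \<notin> states (cube_ext as)" "\<epsilon>' \<notin> states (cube_ext as)"
        show ?thesis
          by (rule step_coherence[OF w finite_lessThan not_in_cube_ext(1)[OF \<epsilon>(1) *(1)] less
              not_in_cube_ext(2)[OF \<epsilon>(2) *(2)] g'(4)[OF ne] inner[OF \<epsilon>(1) *(1)]
              inner[OF \<epsilon>(2) *(2)]])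
      qed
    qed
    then have "(fst h, snd h) \<in> hdts_hom (cube as) X"
      unfolding cube_hom_step_iff[OF w] h1 using g'(2,3) in_states ext by (auto simp: PiE_def)
    then have "h \<in> hdts_hom (cube as) X"
      by simp
    moreover have "snd h \<in> actions (cube as) \<rightarrow>\<^sub>E actions X"
      using g'(2) h1 by simp
    ultimately show ?L
      using restriction_to_cube_ext_iff[OF g] outer h1 by blast
  qed
qed

lemma ex1_PiE_iff: "(\<exists>!f. f \<in> Pi\<^sub>E I S) \<longleftrightarrow> (\<forall>i \<in> I. \<exists>x. S i = {x})"
proof
  assume "\<exists>!f. f \<in> Pi\<^sub>E I S"
  then obtain f where f: "Pi\<^sub>E I S = {f}"
    by blast
  then have "f = restrict f I"
    by (metis PiE_restrict singletonI)
  then have "Pi\<^sub>E I S = {\<lambda>i\<in>I. f i}"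
    using f by simp
  then show "\<forall>i \<in> I. \<exists>x. S i = {x}"
    unfolding PiE_eq_singleton by blast
next
  assume "\<forall>i \<in> I. \<exists>x. S i = {x}"
  then obtain f where "\<forall>i \<in> I. S i = {f i}"
    by metis
  then have "Pi\<^sub>E I S = {\<lambda>i\<in>I. f i}"
    unfolding PiE_eq_singleton .
  then show "\<exists>!f. f \<in> Pi\<^sub>E I S"
    by simp
qed

lemma ex1_fst_iff: "(\<exists>!h. fst h \<in> P \<and> snd h = c) \<longleftrightarrow> (\<exists>!f. f \<in> P)"
proof
  assume "\<exists>!h. fst h \<in> P \<and> snd h = c"
  then obtain h where h: "fst h \<in> P" and eq: "\<And>k. fst k \<in> P \<and> snd k = c \<Longrightarrow> k = h"
    by blast
  show "\<exists>!f. f \<in> P"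
  proof (rule ex1I[of _ "fst h"])
    show "fst h \<in> P" by (rule h)
    show "f = fst h" if "f \<in> P" for f
      using eq[of "(f, c)"] that by force
  qed
next
  assume "\<exists>!f. f \<in> P"
  then show "\<exists>!h. fst h \<in> P \<and> snd h = c"
    by (auto simp: prod_eq_iff)
qed

lemma orthogonal_to_cube_inclusion_iff:
  assumes w: "weak_hdts \<Sigma> X"
  shows "orthogonal_to_map X (cube_inclusion as) \<longleftrightarrow>
    (\<forall>g \<in> hdts_hom (cube_ext as) X. \<forall>\<epsilon> \<in> states (cube as). \<exists>\<nu>. vertex_states X as g \<epsilon> = {\<nu>})"
  unfolding orthogonal_to_map_def cube_inclusion_def prod.case
  by (intro ball_cong refl)
    (simp only: cube_extension_iff[OF w] ex1_fst_iff ex1_PiE_iff)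

text \<open>
  The labels \<open>a\<^sub>i\<close> are read off the actions of the transition. Pairing them with their positions
  keeps repeated actions apart, so the map on actions is well defined.
\<close>

lemma trans_cube_ext_hom:
  assumes w: "weak_hdts \<Sigma> X" and t: "(\<alpha>, u, \<beta>) \<in> trans X"
  obtains as g where "set as \<subseteq> \<Sigma>" "length as = length u" "g \<in> hdts_hom (cube_ext as) X"
    "fst g (replicate (length u) 0) = \<alpha>" "fst g (replicate (length u) 1) = \<beta>"
    "\<And>i. i < length u \<Longrightarrow> snd g (as ! i, i) = u ! i"
proof -
  define as where "as = map (label X) u"
  define g\<^sub>0 where "g\<^sub>0 = (\<lambda>\<epsilon> \<in> states (cube_ext as). if ones \<epsilon> = {} then \<alpha> else \<beta>)"
  define g\<^sub>1 where "g\<^sub>1 = (\<lambda>x \<in> actions (cube as). u ! snd x)"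
  have len: "length as = length u" by (simp add: as_def)
  note wf = trans_wf[OF w t]
  have v: "g\<^sub>0 (replicate (length u) 0) = \<alpha>" "g\<^sub>0 (replicate (length u) 1) = \<beta>"
    using wf(4) by (auto simp: g\<^sub>0_def len)
  have a: "g\<^sub>1 (as ! i, i) = u ! i" if "i < length u" for i
    using that by (auto simp: g\<^sub>1_def cube_def len)
  have act: "\<exists>i < length u. x = (as ! i, i)" if "x \<in> actions (cube as)" for x
    using that by (auto simp: cube_def len)
  have "g\<^sub>0 \<in> states (cube_ext as) \<rightarrow>\<^sub>E states X"
    using wf by (auto simp: g\<^sub>0_def)
  moreover have "g\<^sub>1 \<in> actions (cube as) \<rightarrow>\<^sub>E actions X"
  proof
    fix x assume "x \<in> actions (cube as)"
    then obtain i where "i < length u" "x = (as ! i, i)" using act by blast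
    then show "g\<^sub>1 x \<in> actions X" using a wf(3) by auto
  qed (simp add: g\<^sub>1_def)
  moreover have "label X (g\<^sub>1 x) = fst x" if "x \<in> actions (cube as)" for x
    using act[OF that] a by (auto simp: as_def)
  moreover have "step X (\<lambda>i. g\<^sub>1 (as ! i, i)) \<alpha> {..<length u} \<beta>"
  proof -
    have "map (\<lambda>i. g\<^sub>1 (as ! i, i)) [0..<length u] = u"
      by (intro nth_equalityI) (simp_all add: a)
    then show ?thesis
      using t step_set_iff[OF w, of "[0..<length u]"] by (simp add: atLeast0LessThan)
  qed
  ultimately have "(g\<^sub>0, g\<^sub>1) \<in> hdts_hom (cube_ext as) X"
    unfolding cube_ext_hom_step_iff[OF w] using v by (simp add: len)
  moreover have "set as \<subseteq> \<Sigma>"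
    using w wf(3) unfolding weak_hdts_def as_def by auto
  ultimately show thesis
    using that[of as "(g\<^sub>0, g\<^sub>1)"] len v a by simp
qed

theorem theorem5p6:
  fixes \<Sigma> :: "'a set" and X :: "('s, 'l, 'a) hdts"
  assumes "\<Sigma> \<noteq> {}" and "weak_hdts \<Sigma> X"
  shows "unique_intermediate_state X \<longleftrightarrow> orthogonal_to_set X (cube_inclusions \<Sigma>)"
proof
  note w = assms(2)
  assume uis: "unique_intermediate_state X"
  have "\<exists>\<nu>. vertex_states X as g \<epsilon> = {\<nu>}"
    if g: "g \<in> hdts_hom (cube_ext as) X" and \<epsilon>: "\<epsilon> \<in> states (cube as)" for as g \<epsilon>
  proof (cases "\<epsilon> \<in> states (cube_ext as)")
    case False
    note A = not_in_cube_ext[OF \<epsilon> False]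
    have "as \<noteq> []"
      using A by auto
    then have "step X (\<lambda>i. snd g (as ! i, i)) (fst g (replicate (length as) 0)) {..<length as}
        (fst g (replicate (length as) 1))"
      using g cube_ext_hom_step_iff[OF w, of "fst g" "snd g" as] by simp
    from unique_intermediate_state_step[OF w uis finite_lessThan A this]
    show ?thesis
      using False by (simp add: vertex_states_def del: states_cube_ext)
  qed (simp add: vertex_states_def)
  then show "orthogonal_to_set X (cube_inclusions \<Sigma>)"
    unfolding orthogonal_to_set_def cube_inclusions_def
    using orthogonal_to_cube_inclusion_iff[OF w] by blast
next
  note w = assms(2)
  assume orth: "orthogonal_to_set X (cube_inclusions \<Sigma>)"
  show "unique_intermediate_state X"
    unfolding unique_intermediate_state_def
  proof (intro allI impI)
    fix \<alpha> u \<beta> p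
    assume p: "1 \<le> p" "p < length u" and t: "(\<alpha>, u, \<beta>) \<in> trans X"
    obtain as g where as: "set as \<subseteq> \<Sigma>" "length as = length u"
      and g: "g \<in> hdts_hom (cube_ext as) X"
        "fst g (replicate (length u) 0) = \<alpha>" "fst g (replicate (length u) 1) = \<beta>"
        "\<And>i. i < length u \<Longrightarrow> snd g (as ! i, i) = u ! i"
      using trans_cube_ext_hom[OF w t] by metis
    \<comment> \<open>The intermediate states after \<open>p\<close> actions are the candidates at the vertex \<open>1\<^sup>p 0\<^sup>n\<^sup>-\<^sup>p\<close>.\<close>
    let ?U = "\<lambda>i. snd g (as ! i, i)" and ?\<epsilon> = "replicate p 1 @ replicate (length u - p) (0::nat)"
    have ones: "ones ?\<epsilon> = {..<p}"
      using p by (auto simp: ones_def nth_append)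
    have \<epsilon>: "?\<epsilon> \<in> states (cube as)"
      using p as(2) by (auto simp: cube_def)
    have "ones ?\<epsilon> \<noteq> {}" "ones ?\<epsilon> \<noteq> {..<length u}"
      using ones p by (auto simp: lessThan_empty_iff)
    then have ne: "?\<epsilon> \<notin> states (cube_ext as)"
      using as(2) by (metis states_cube_ext insertE singletonD ones_replicate One_nat_def)
    have "orthogonal_to_map X (cube_inclusion as)"
      using orth as(1) unfolding orthogonal_to_set_def cube_inclusions_def by blast
    then obtain \<nu> where "vertex_states X as g ?\<epsilon> = {\<nu>}"
      using g(1) \<epsilon> orthogonal_to_cube_inclusion_iff[OF w] by blast
    then have "intermediate_states X ?U \<alpha> \<beta> {..<length u} {..<p} = {\<nu>}"
      using ne ones g(2,3) as(2) by (simp add: vertex_states_def del: states_cube_ext)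
    moreover have "{..<p} = set [0..<p]" "{..<length u} - {..<p} = set [p..<length u]"
      by auto
    moreover have "map ?U [0..<p] = take p u" "map ?U [p..<length u] = drop p u"
      using p g(4) by (auto intro!: nth_equalityI)
    ultimately have "{\<nu>'. (\<alpha>, take p u, \<nu>') \<in> trans X \<and> (\<nu>', drop p u, \<beta>) \<in> trans X} = {\<nu>}"
      unfolding intermediate_states_def
      using step_set_iff[OF w distinct_upt, of ?U] by simp
    then have \<nu>: "(\<alpha>, take p u, \<nu>') \<in> trans X \<and> (\<nu>', drop p u, \<beta>) \<in> trans X \<longleftrightarrow> \<nu>' = \<nu>" for \<nu>'
      by (simp add: set_eq_iff)
    have st: "\<nu> \<in> states X"
      using \<nu>[of \<nu>] trans_wf(1)[OF w, of \<nu> "drop p u" \<beta>] by simp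
    have "\<nu>' \<in> states X \<and> (\<alpha>, take p u, \<nu>') \<in> trans X \<and> (\<nu>', drop p u, \<beta>) \<in> trans X
        \<longleftrightarrow> \<nu>' = \<nu>" for \<nu>'
      using \<nu>[of \<nu>'] st by auto
    then show "\<exists>!\<nu>. \<nu> \<in> states X \<and> (\<alpha>, take p u, \<nu>) \<in> trans X \<and> (\<nu>, drop p u, \<beta>) \<in> trans X"
      by (simp only: ex1_eq(1))
  qed
qed

end
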